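(* Let $G$ be a graph with $m$ edges. Then $$\mathrm{sp}(G)\geq \frac{1}{\pi}\cdot\frac{m}{\chi_{\mathrm{vec}}(G)-1}.$$
   Context: All graphs are finite and simple. For a graph $G$, $\mathrm{mc}(G)$ is the maximum number of edges of a bipartite subgraph of $G$ and $\mathrm{sp}(G)=\mathrm{mc}(G)-e(G)/2$, where $e(G)$ is the number of edges. The vector chromatic number $\chi_{\mathrm{vec}}(G)$ is the minimal real $\kappa\geq 2$ for which there exists a unit vector $\mathbf{x}_v$ in some Euclidean space for each vertex $v$ of $G$ such that $\langle \mathbf{x}_u,\mathbf{x}_v\rangle\leq -\frac{1}{\kappa-1}$ whenever $u,v$ are distinct vertices with $uv\in E(G)$. *)

theory Defs
  imports Complex_Main "Jordan_Normal_Form.Matrix"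
begin

text \<open>A graph is given by its vertex set and its set of edges, an edge being the unordered
  pair of its two ends.\<close>

definition simple_graph :: "'a set \<Rightarrow> 'a set set \<Rightarrow> bool" where
  "simple_graph V E \<longleftrightarrow> finite V \<and> (\<forall>e\<in>E. e \<subseteq> V \<and> card e = 2)"

definition subgraph :: "'a set \<Rightarrow> 'a set set \<Rightarrow> 'a set \<Rightarrow> 'a set set \<Rightarrow> bool" where
  "subgraph V' E' V E \<longleftrightarrow> simple_graph V' E' \<and> V' \<subseteq> V \<and> E' \<subseteq> E"

definition bipartite :: "'a set \<Rightarrow> 'a set set \<Rightarrow> bool" where
  "bipartite V E \<longleftrightarrow>
     (\<exists>A B. A \<union> B = V \<and> A \<inter> B = {} \<and> (\<forall>e\<in>E. \<exists>a\<in>A. \<exists>b\<in>B. e = {a, b}))"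

definition mc :: "'a set \<Rightarrow> 'a set set \<Rightarrow> nat" where
  "mc V E = Max {card E' | V' E'. subgraph V' E' V E \<and> bipartite V' E'}"

definition sp :: "'a set \<Rightarrow> 'a set set \<Rightarrow> real" where
  "sp V E = real (mc V E) - real (card E) / 2"

text \<open>The dimension of the Euclidean space is quantified, so it cannot be a type; the space of
  dimension \<open>d\<close> is \<open>carrier_vec d\<close> with the standard scalar product.\<close>

definition vector_colouring ::
  "real \<Rightarrow> nat \<Rightarrow> ('a \<Rightarrow> real vec) \<Rightarrow> 'a set \<Rightarrow> 'a set set \<Rightarrow> bool" where
  "vector_colouring \<kappa> d x V E \<longleftrightarrow>
     (\<forall>v\<in>V. x v \<in> carrier_vec d \<and> sqrt (x v \<bullet> x v) = 1) \<and>
     (\<forall>u\<in>V. \<forall>v\<in>V. u \<noteq> v \<and> {u, v} \<in> E \<longrightarrow> x u \<bullet> x v \<le> - (1 / (\<kappa> - 1)))"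

text \<open>For a finite simple graph the minimum is attained: a simplex gives a vector colouring
  with \<open>\<kappa> = max 2 (card V)\<close>, and the Gram matrices of vector colourings form a
  compact set. So \<open>LEAST\<close> is well defined here.\<close>

definition chi_vec :: "'a set \<Rightarrow> 'a set set \<Rightarrow> real" where
  "chi_vec V E = (LEAST \<kappa>::real. \<kappa> \<ge> 2 \<and> (\<exists>d x. vector_colouring \<kappa> d x V E))"

end

theory Submission
  imports Defs "HOL-Probability.Characteristic_Functions"
begin

text \<open>Write \<open>t = 1 / (\<kappa> - 1)\<close> and choose a random cut from a Gaussian vector \<open>g\<close>, as in the
  rounding of Goemans and Williamson, but with a bounded odd trigonometric polynomial \<open>\<phi>\<close> in place of
  the sign function: vertex \<open>v\<close> receives a random sign of mean \<open>\<phi> (g \<bullet> x\<^sub>v)\<close>. Expectations are then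
  finite sums computed from the characteristic function of the normal distribution, namely
  \<open>E [sin (a (g \<bullet> x)) sin (b (g \<bullet> y))] = exp (- (a\<^sup>2 + b\<^sup>2) / 2) sinh (a b (x \<bullet> y))\<close>, and no rotation
  invariance is needed. As \<open>sinh z \<le> z\<close> for \<open>z \<le> 0\<close>, an edge contributes at most \<open>- t c\<^sup>2\<close> to the
  expected sum of products of signs, where \<open>c = E [Z \<phi> (Z)]\<close> for a standard normal \<open>Z\<close>. Letting \<open>\<phi>\<close>
  run through truncated, Abel-damped Fourier series of square waves of growing period drives \<open>c\<^sup>2\<close> to
  \<open>2 / \<pi>\<close>.\<close>


section \<open>Cuts and sign vectors\<close>

lemma simple_graph_edge:
  assumes "simple_graph V E" "e \<in> E"
  obtains u v where "e = {u, v}" "u \<noteq> v" "u \<in> V" "v \<in> V"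
  using assms unfolding simple_graph_def card_2_iff by (metis insert_subset)

lemma simple_graph_finite_edges: "simple_graph V E \<Longrightarrow> finite E"
  unfolding simple_graph_def by (rule finite_subset[of E "Pow V"]) auto

lemma card_le_mc:
  assumes "simple_graph V E" "subgraph V' E' V E" "bipartite V' E'"
  shows "card E' \<le> mc V E"
  unfolding mc_def
proof (rule Max_ge)
  have "{card E' |V' E'. subgraph V' E' V E \<and> bipartite V' E'} \<subseteq> card ` Pow E"
    by (auto simp: subgraph_def)
  then show "finite {card E' |V' E'. subgraph V' E' V E \<and> bipartite V' E'}"
    using simple_graph_finite_edges[OF assms(1)] by (meson finite_Pow_iff finite_imageI finite_subset)
qed (use assms in blast)

text \<open>An edge has product -1 exactly when the partition by sign cuts it. The sum is therefore
  \<open>card E\<close> minus twice the size of the cut \<open>C\<close>, and \<open>C\<close> is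
  bipartite.\<close>

lemma sum_prod_signs_ge:
  fixes s :: "'a \<Rightarrow> real"
  assumes G: "simple_graph V E" and s: "\<And>v. v \<in> V \<Longrightarrow> s v = 1 \<or> s v = -1"
  shows "real (card E) - 2 * real (mc V E) \<le> (\<Sum>e\<in>E. \<Prod>v\<in>e. s v)"
proof -
  define C where "C = {e \<in> E. (\<Prod>v\<in>e. s v) = -1}"
  have finE: "finite E" by (rule simple_graph_finite_edges[OF G])
  have val: "(\<Prod>v\<in>e. s v) = 1 - 2 * of_bool (e \<in> C)" if "e \<in> E" for e
    using G that
  proof (rule simple_graph_edge)
    fix u v assume "e = {u, v}" "u \<noteq> v" "u \<in> V" "v \<in> V"
    with s[of u] s[of v] that show ?thesis by (auto simp: C_def)
  qed
  have "bipartite V C"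
    unfolding bipartite_def
  proof (intro exI conjI ballI)
    show "{v \<in> V. s v = 1} \<union> {v \<in> V. s v = -1} = V" using s by auto
    show "{v \<in> V. s v = 1} \<inter> {v \<in> V. s v = -1} = {}" by auto
    fix e assume e: "e \<in> C"
    then have "e \<in> E" by (simp add: C_def)
    from G this show "\<exists>a\<in>{v \<in> V. s v = 1}. \<exists>b\<in>{v \<in> V. s v = -1}. e = {a, b}"
    proof (rule simple_graph_edge)
      fix u v assume *: "e = {u, v}" "u \<noteq> v" "u \<in> V" "v \<in> V"
      then have "s u * s v = -1" using e by (simp add: C_def)
      then consider "s u = 1" "s v = -1" | "s u = -1" "s v = 1" using s[of u] s[of v] * by auto
      then show ?thesis using * by cases (auto simp: insert_commute)
    qed
  qed
  moreover have "subgraph V C V E"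
    using G by (auto simp: subgraph_def simple_graph_def C_def)
  ultimately have "card C \<le> mc V E" using G by (intro card_le_mc)
  moreover have "(\<Sum>e\<in>E. \<Prod>v\<in>e. s v) = real (card E) - 2 * real (card C)"
  proof -
    have "E \<inter> C = C" by (auto simp: C_def)
    then show ?thesis
      using finE by (simp add: val sum_subtractf sum_distrib_left[symmetric] of_bool_def sum.If_cases)
  qed
  ultimately show ?thesis by simp
qed

text \<open>The sum is affine in each \<open>p w\<close>, so on the cube it is minimised at a vertex.\<close>
lemma sum_prod_cube_ge:
  fixes p :: "'a \<Rightarrow> real"
  assumes signs: "\<And>s. (\<And>v. v \<in> V \<Longrightarrow> s v = 1 \<or> s v = -1) \<Longrightarrow> B \<le> (\<Sum>e\<in>E. \<Prod>v\<in>e. s v)"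
    and fin: "finite V" "\<And>e. e \<in> E \<Longrightarrow> finite e"
    and p: "\<And>v. v \<in> V \<Longrightarrow> \<bar>p v\<bar> \<le> 1"
  shows "B \<le> (\<Sum>e\<in>E. \<Prod>v\<in>e. p v)"
proof -
  \<comment> \<open>\<open>W\<close> collects the vertices whose value may still be fractional; each
    induction step rounds one of them to a sign.\<close>
  have "B \<le> (\<Sum>e\<in>E. \<Prod>v\<in>e. p v)"
    if "finite W" "\<And>v. v \<in> W \<Longrightarrow> \<bar>p v\<bar> \<le> 1" "\<And>v. v \<in> V - W \<Longrightarrow> p v = 1 \<or> p v = -1" for W and p :: "'a \<Rightarrow> real"
    using that
  proof (induction W arbitrary: p rule: finite_induct)
    case empty
    then show ?case by (intro signs) simp
  next
    case (insert w W)
    define F where "F x = (\<Sum>e\<in>E. \<Prod>v\<in>e. (p(w := x)) v)" for x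
    have affine: "F x = (1 + x) / 2 * F 1 + (1 - x) / 2 * F (-1)" for x
      unfolding F_def sum_distrib_left sum.distrib[symmetric]
    proof (intro sum.cong refl)
      fix e assume "e \<in> E"
      \<comment> \<open>An edge is a set, so \<open>w\<close> enters its product at most once; this
        makes \<open>F\<close> affine.\<close>
      define R where "R = (\<Prod>v\<in>e - {w}. p v)"
      have R: "(\<Prod>v\<in>e. (p(w := y)) v) = (if w \<in> e then y * R else R)" for y
      proof (cases "w \<in> e")
        case True
        then show ?thesis
          using fin(2)[OF \<open>e \<in> E\<close>] by (simp add: prod.remove[of e w] R_def)
      next
        case False
        then show ?thesis unfolding R_def by (auto intro!: prod.cong)
      qed
      show "(\<Prod>v\<in>e. (p(w := x)) v)
        = (1 + x) / 2 * (\<Prod>v\<in>e. (p(w := 1)) v) + (1 - x) / 2 * (\<Prod>v\<in>e. (p(w := -1)) v)"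
        unfolding R by (simp add: field_simps)
    qed
    have "B \<le> F 1" "B \<le> F (-1)"
      unfolding F_def by (intro insert.IH; use insert.prems insert.hyps in force)+
    moreover have "\<bar>p w\<bar> \<le> 1" using insert.prems by simp
    ultimately have "(1 + p w) / 2 * B + (1 - p w) / 2 * B \<le> F (p w)"
      unfolding affine[of "p w"] by (intro add_mono mult_left_mono) auto
    then show ?case by (simp add: F_def field_simps)
  qed
  from this[OF fin(1), of p] p show ?thesis by simp
qed

section \<open>Gram matrices and the vector chromatic number\<close>

definition psd_on :: "'a set \<Rightarrow> ('a \<Rightarrow> 'a \<Rightarrow> real) \<Rightarrow> bool" where
  "psd_on V G \<longleftrightarrow> (\<forall>u\<in>V. \<forall>v\<in>V. G u v = G v u) \<and> (\<forall>c. 0 \<le> (\<Sum>u\<in>V. \<Sum>v\<in>V. c u * c v * G u v))"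

lemma psd_on_sym: "psd_on V G \<Longrightarrow> u \<in> V \<Longrightarrow> v \<in> V \<Longrightarrow> G u v = G v u"
  and psd_on_nonneg: "psd_on V G \<Longrightarrow> 0 \<le> (\<Sum>u\<in>V. \<Sum>v\<in>V. c u * c v * G u v)"
  unfolding psd_on_def by blast+

text \<open>The quadratic form is the squared norm of the combination of the vectors
  \<open>x v\<close> with coefficients \<open>c v\<close>.\<close>

lemma psd_on_gram: "psd_on V (\<lambda>u v. \<Sum>i<d. x u i * x v i)"
  unfolding psd_on_def
proof (intro conjI allI ballI)
  fix c
  have "(\<Sum>u\<in>V. \<Sum>v\<in>V. c u * c v * (\<Sum>i<d. x u i * x v i)) = (\<Sum>u\<in>V. \<Sum>v\<in>V. \<Sum>i<d. (c u * x u i) * (c v * x v i))"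
    by (simp add: sum_distrib_left mult_ac)
  also have "\<dots> = (\<Sum>u\<in>V. \<Sum>i<d. \<Sum>v\<in>V. (c u * x u i) * (c v * x v i))"
    by (intro sum.cong refl sum.swap)
  also have "\<dots> = (\<Sum>i<d. \<Sum>u\<in>V. \<Sum>v\<in>V. (c u * x u i) * (c v * x v i))"
    by (rule sum.swap)
  also have "\<dots> = (\<Sum>i<d. (\<Sum>v\<in>V. c v * x v i)\<^sup>2)"
    by (simp add: power2_eq_square sum_product)
  finally show "0 \<le> (\<Sum>u\<in>V. \<Sum>v\<in>V. c u * c v * (\<Sum>i<d. x u i * x v i))"
    by (simp add: sum_nonneg)
qed (intro sum.cong refl mult.commute)

text \<open>Separating the coefficient \<open>a\<close> of \<open>w\<close> leaves a quadratic
  polynomial in \<open>a\<close>, in which the square can be completed to eliminate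
  \<open>w\<close>.\<close>

lemma psd_on_insert_form:
  assumes "finite V" "w \<notin> V" "psd_on (insert w V) G"
  shows "0 \<le> a\<^sup>2 * G w w + 2 * a * (\<Sum>v\<in>V. c v * G w v) + (\<Sum>u\<in>V. \<Sum>v\<in>V. c u * c v * G u v)"
proof -
  let ?c = "c(w := a)"
  have sym: "G u w = G w u" if "u \<in> V" for u
    using psd_on_sym[OF assms(3)] that by blast
  have c: "?c v = c v" if "v \<in> V" for v using that assms(2) by auto
  have row: "(\<Sum>v\<in>insert w V. ?c v * h v) = a * h w + (\<Sum>v\<in>V. c v * h v)" for h :: "'a \<Rightarrow> real"
    unfolding sum.insert[OF assms(1,2)] by (simp add: c cong: sum.cong del: fun_upd_apply) simp
  have "0 \<le> (\<Sum>u\<in>insert w V. \<Sum>v\<in>insert w V. ?c u * ?c v * G u v)"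
    by (rule psd_on_nonneg[OF assms(3)])
  also have "\<dots> = a * (a * G w w + (\<Sum>v\<in>V. c v * G w v))
      + (\<Sum>u\<in>V. c u * (a * G u w + (\<Sum>v\<in>V. c v * G u v)))"
    by (simp only: mult.assoc sum_distrib_left[symmetric] row)
  also have "(\<Sum>u\<in>V. c u * (a * G u w + (\<Sum>v\<in>V. c v * G u v)))
      = (\<Sum>u\<in>V. a * (c u * G w u) + (\<Sum>v\<in>V. c u * c v * G u v))"
    by (intro sum.cong refl) (simp only: sym distrib_left sum_distrib_left mult_ac)
  also have "\<dots> = a * (\<Sum>v\<in>V. c v * G w v) + (\<Sum>u\<in>V. \<Sum>v\<in>V. c u * c v * G u v)"
    by (simp only: sum.distrib sum_distrib_left)
  also have "a * (a * G w w + (\<Sum>v\<in>V. c v * G w v)) + (a * (\<Sum>v\<in>V. c v * G w v) + (\<Sum>u\<in>V. \<Sum>v\<in>V. c u * c v * G u v))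
    = a\<^sup>2 * G w w + 2 * a * (\<Sum>v\<in>V. c v * G w v) + (\<Sum>u\<in>V. \<Sum>v\<in>V. c u * c v * G u v)"
    by (simp add: power2_eq_square distrib_left)
  finally show ?thesis .
qed

text \<open>This is the form at the vector with entry \<open>a\<close> at \<open>u\<close>, 1 at
  \<open>v\<close> and 0 elsewhere. It yields both the vanishing of rows with zero pivot and the
  bound 1 on the entries of a kernel with unit diagonal.\<close>

lemma psd_on_pair_form:
  assumes "finite V" "psd_on V G" "u \<in> V" "v \<in> V" "u \<noteq> v"
  shows "0 \<le> a\<^sup>2 * G u u + 2 * a * G u v + G v v"
proof -
  let ?c = "\<lambda>w. if w = v then 1 else 0 :: real"
  have V: "insert u (V - {u}) = V" using assms(3) by blast
  have sum: "(\<Sum>w\<in>V - {u}. ?c w * h w) = h v" for h :: "'a \<Rightarrow> real"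
  proof -
    have "(\<Sum>w\<in>V - {u}. ?c w * h w) = (\<Sum>w\<in>V - {u}. if w = v then h w else 0)"
      by (intro sum.cong) auto
    then show ?thesis using assms by simp
  qed
  have "(\<Sum>w\<in>V - {u}. \<Sum>w'\<in>V - {u}. ?c w * ?c w' * G w w') = G v v"
    by (simp only: mult.assoc sum_distrib_left[symmetric] sum)
  moreover have "(\<Sum>w\<in>V - {u}. ?c w * G u w) = G u v" by (rule sum)
  ultimately show ?thesis
    using psd_on_insert_form[of "V - {u}" u G a ?c] assms(1,2) by (simp only: V) simp
qed

text \<open>Cholesky factorisation, one pivot at a time. For a zero pivot the whole row vanishes, and
  \<open>x / 0 = 0\<close> makes the generic formulas correct.\<close>
lemma psd_on_imp_gram:
  assumes "finite V" "psd_on V G"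
  shows "\<exists>x::'a \<Rightarrow> nat \<Rightarrow> real. \<forall>u\<in>V. \<forall>v\<in>V. (\<Sum>i<card V. x u i * x v i) = G u v"
  using assms
proof (induction V arbitrary: G rule: finite_induct)
  case empty
  then show ?case by simp
next
  case (insert w V)
  note form = psd_on_insert_form[OF insert.hyps insert.prems]
  have sym: "G u v = G v u" if "u \<in> insert w V" "v \<in> insert w V" for u v
    using psd_on_sym[OF insert.prems] that by blast
  have diag: "0 \<le> G w w" using form[of 1 "\<lambda>_. 0"] by simp
  have row: "G w u = 0" if "G w w = 0" "u \<in> V" for u
  proof (rule ccontr)
    assume nz: "G w u \<noteq> 0"
    \<comment> \<open>With a zero pivot the pair form is affine in \<open>a\<close>; this value
      makes it equal to -1.\<close>
    define a where "a = - (G u u + 1) / (2 * G w u)"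
    have "0 \<le> 2 * a * G w u + G u u"
      using psd_on_pair_form[OF _ insert.prems, of w u a] that insert.hyps by auto
    moreover have "2 * a * G w u = - (G u u + 1)" using nz by (simp add: a_def field_simps)
    ultimately show False by simp
  qed
  \<comment> \<open>The Schur complement of the pivot \<open>w\<close>.\<close>
  define H where "H u v = G u v - G w u * G w v / G w w" for u v
  have "psd_on V H"
    unfolding psd_on_def
  proof (intro conjI ballI allI)
    show "H u v = H v u" if "u \<in> V" "v \<in> V" for u v
      using sym[of u v] that by (simp add: H_def mult.commute)
    fix c :: "'a \<Rightarrow> real"
    define L where "L = (\<Sum>v\<in>V. c v * G w v)"
    define Q where "Q = (\<Sum>u\<in>V. \<Sum>v\<in>V. c u * c v * G u v)"
    have "(\<Sum>u\<in>V. \<Sum>v\<in>V. c u * c v * H u v) = Q - (\<Sum>u\<in>V. \<Sum>v\<in>V. (c u * G w u) * (c v * G w v)) / G w w"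
      unfolding H_def Q_def sum_divide_distrib sum_subtractf[symmetric]
      by (intro sum.cong refl) (simp add: algebra_simps)
    also have "\<dots> = Q - L\<^sup>2 / G w w"
      by (simp add: L_def power2_eq_square sum_product)
    also have "\<dots> \<ge> 0"
      \<comment> \<open>This is the minimiser in \<open>a\<close> when the pivot is positive. For a
        zero pivot it is 0, and the form reduces to \<open>Q\<close>.\<close>
      using form[of "- L / G w w" c, folded L_def Q_def]
      by (cases "G w w = 0") (simp_all add: power2_eq_square)
    finally show "0 \<le> (\<Sum>u\<in>V. \<Sum>v\<in>V. c u * c v * H u v)" .
  qed
  from insert.IH[OF this] obtain x :: "'a \<Rightarrow> nat \<Rightarrow> real" where
    x: "\<And>u v. u \<in> V \<Longrightarrow> v \<in> V \<Longrightarrow> (\<Sum>i<card V. x u i * x v i) = H u v" by blast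
  \<comment> \<open>The new coordinate \<open>card V\<close> carries the row of the pivot, scaled by
    its square root; \<open>w\<close> is 0 in all old coordinates.\<close>
  define y where "y u i = (if i = card V then G w u / sqrt (G w w) else if u = w then 0 else x u i)" for u i
  have pivot: "G w u / sqrt (G w w) * (G w v / sqrt (G w w)) = G w u * G w v / G w w" for u v
    using diag by simp
  have "(\<Sum>i<card (insert w V). y u i * y v i) = G u v" if "u \<in> insert w V" "v \<in> insert w V" for u v
  proof -
    have "(\<Sum>i<card (insert w V). y u i * y v i)
      = (\<Sum>i<card V. (if u = w then 0 else x u i) * (if v = w then 0 else x v i)) + G w u * G w v / G w w"
      using insert.hyps diag by (simp add: y_def pivot)
    also have "\<dots> = G u v"
    proof (cases "u = w \<or> v = w")
      case True
      then show ?thesis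
        using that row[of u] row[of v] sym[of u w] by (cases "G w w = 0") auto
    next
      case False
      then show ?thesis using that x[of u v] by (auto simp: H_def)
    qed
    finally show ?thesis .
  qed
  then show ?case by blast
qed

section \<open>Compactness and attainment of the vector chromatic number\<close>

lemma finite_simultaneous_subseq:
  fixes f :: "nat \<Rightarrow> 'b \<Rightarrow> real"
  assumes "finite P" "\<And>p n. p \<in> P \<Longrightarrow> \<bar>f n p\<bar> \<le> B"
  shows "\<exists>r. strict_mono r \<and> (\<forall>p\<in>P. \<exists>l. (\<lambda>n. f (r n) p) \<longlonglongrightarrow> l)"
  using assms
proof (induction P rule: finite_induct)
  case empty
  show ?case using strict_mono_id by auto
next
  case (insert q P)
  then obtain r where r: "strict_mono r" "\<And>p. p \<in> P \<Longrightarrow> \<exists>l. (\<lambda>n. f (r n) p) \<longlonglongrightarrow> l"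
    by auto
  \<comment> \<open>Bolzano-Weierstrass for the coordinate \<open>q\<close>, along a subsequence
    that already serves all of \<open>P\<close>.\<close>
  have "\<forall>n. f (r n) q \<in> {-B..B}" using insert.prems[of q] by (auto simp: abs_le_iff minus_le_iff)
  from seq_compactE[OF compact_imp_seq_compact[OF compact_Icc] this]
  obtain l s where s: "strict_mono s" "((\<lambda>n. f (r n) q) \<circ> s) \<longlonglongrightarrow> l"
    by blast
  have "\<exists>l. (\<lambda>n. f ((r \<circ> s) n) p) \<longlonglongrightarrow> l" if "p \<in> insert q P" for p
    using that
  proof
    assume "p = q" then show ?thesis using s(2) by (auto simp: o_def)
  next
    assume "p \<in> P"
    then obtain l where "(\<lambda>n. f (r n) p) \<longlonglongrightarrow> l" using r(2) by blast
    from LIMSEQ_subseq_LIMSEQ[OF this s(1)] show ?thesis by (auto simp: o_def)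
  qed
  moreover have "strict_mono (r \<circ> s)" using r(1) s(1) by (rule strict_mono_o)
  ultimately show ?case by blast
qed

lemma vector_colouring_gram:
  assumes "vector_colouring \<kappa> d x V E"
  shows "u \<in> V \<Longrightarrow> v \<in> V \<Longrightarrow> x u \<bullet> x v = (\<Sum>i<d. vec_index (x u) i * vec_index (x v) i)"
    and "v \<in> V \<Longrightarrow> (\<Sum>i<d. vec_index (x v) i * vec_index (x v) i) = 1"
    and "u \<in> V \<Longrightarrow> v \<in> V \<Longrightarrow> u \<noteq> v \<Longrightarrow> {u, v} \<in> E \<Longrightarrow>
      (\<Sum>i<d. vec_index (x u) i * vec_index (x v) i) \<le> - (1 / (\<kappa> - 1))"
proof -
  show prod: "x u \<bullet> x v = (\<Sum>i<d. vec_index (x u) i * vec_index (x v) i)" if "u \<in> V" "v \<in> V" for u v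
  proof -
    have "dim_vec (x v) = d" using assms that unfolding vector_colouring_def by auto
    then show ?thesis by (simp add: scalar_prod_def atLeast0LessThan)
  qed
  show "(\<Sum>i<d. vec_index (x v) i * vec_index (x v) i) = 1" if "v \<in> V" for v
    using assms that unfolding vector_colouring_def prod[OF that that, symmetric] by auto
  show "(\<Sum>i<d. vec_index (x u) i * vec_index (x v) i) \<le> - (1 / (\<kappa> - 1))"
    if "u \<in> V" "v \<in> V" "u \<noteq> v" "{u, v} \<in> E" for u v
    using assms that unfolding vector_colouring_def prod[OF that(1,2), symmetric] by blast
qed

text \<open>A colouring matters only through its Gram matrix, which is indexed by \<open>V\<close>
  whatever the dimension. The unbounded \<open>d\<close> thus disappears and compactness becomes
  available; conversely, factorisation realises the matrix in dimension
  \<open>card V\<close>.\<close>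

lemma vector_colouring_iff_psd:
  assumes "finite V"
  shows "(\<exists>d x. vector_colouring \<kappa> d x V E) \<longleftrightarrow>
    (\<exists>G. psd_on V G \<and> (\<forall>v\<in>V. G v v = 1) \<and> (\<forall>u\<in>V. \<forall>v\<in>V. u \<noteq> v \<and> {u, v} \<in> E \<longrightarrow> G u v \<le> - (1 / (\<kappa> - 1))))"
    (is "?L \<longleftrightarrow> ?R")
proof
  assume ?L
  then obtain d x where col: "vector_colouring \<kappa> d x V E" by blast
  let ?G = "\<lambda>u v. \<Sum>i<d. vec_index (x u) i * vec_index (x v) i"
  have "psd_on V ?G" by (rule psd_on_gram)
  moreover have "\<forall>v\<in>V. ?G v v = 1" using vector_colouring_gram(2)[OF col] by blast
  moreover have "\<forall>u\<in>V. \<forall>v\<in>V. u \<noteq> v \<and> {u, v} \<in> E \<longrightarrow> ?G u v \<le> - (1 / (\<kappa> - 1))"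
    using vector_colouring_gram(3)[OF col] by blast
  ultimately show ?R by (intro exI[of _ ?G] conjI)
next
  assume ?R
  then obtain G where "psd_on V G \<and> (\<forall>v\<in>V. G v v = 1) \<and>
      (\<forall>u\<in>V. \<forall>v\<in>V. u \<noteq> v \<and> {u, v} \<in> E \<longrightarrow> G u v \<le> - (1 / (\<kappa> - 1)))" ..
  then have G: "psd_on V G" "\<And>v. v \<in> V \<Longrightarrow> G v v = 1"
    "\<And>u v. u \<in> V \<Longrightarrow> v \<in> V \<Longrightarrow> u \<noteq> v \<Longrightarrow> {u, v} \<in> E \<Longrightarrow> G u v \<le> - (1 / (\<kappa> - 1))"
    by blast+
  obtain x :: "'a \<Rightarrow> nat \<Rightarrow> real" where
    x: "\<And>u v. u \<in> V \<Longrightarrow> v \<in> V \<Longrightarrow> (\<Sum>i<card V. x u i * x v i) = G u v"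
    using psd_on_imp_gram[OF assms G(1)] by blast
  let ?x = "\<lambda>u. Matrix.vec (card V) (x u)"
  have "?x u \<bullet> ?x v = G u v" if "u \<in> V" "v \<in> V" for u v
    using x[OF that] unfolding scalar_prod_def by (simp add: atLeast0LessThan)
  then have "vector_colouring \<kappa> (card V) ?x V E"
    using G(2,3) unfolding vector_colouring_def by simp
  then show ?L by blast
qed

text \<open>The matrix is (1 + t) I - t J with J the all-ones matrix, so Cauchy-Schwarz in the form
  (sum of c)^2 \<le> n * (sum of c^2), with n = \<open>card V\<close>, suffices. Equality in the
  condition on \<open>t\<close> corresponds to a regular simplex.\<close>

lemma simplex_psd_on:
  assumes fin: "finite V" and t: "0 \<le> t" "t * (real (card V) - 1) \<le> 1"
  shows "psd_on V (\<lambda>u v. if u = v then 1 else - t)"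
  unfolding psd_on_def
proof (intro conjI allI)
  fix c :: "'a \<Rightarrow> real"
  define S where "S = (\<Sum>v\<in>V. (c v)\<^sup>2)"
  have "(\<Sum>u\<in>V. \<Sum>v\<in>V. c u * c v * (if u = v then 1 else - t))
    = (\<Sum>u\<in>V. \<Sum>v\<in>V. (if u = v then (1 + t) * c u * c v else 0) - t * (c u * c v))"
    by (intro sum.cong refl) (simp add: algebra_simps)
  also have "\<dots> = (1 + t) * S - t * (\<Sum>v\<in>V. c v)\<^sup>2"
  proof -
    have "(\<Sum>u\<in>V. \<Sum>v\<in>V. t * (c u * c v)) = t * (\<Sum>v\<in>V. c v)\<^sup>2"
      by (simp only: power2_eq_square sum_product) (simp only: sum_distrib_left)
    then show ?thesis
      using fin by (simp add: sum_subtractf S_def power2_eq_square sum_distrib_left mult.assoc)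
  qed
  also have "\<dots> \<ge> 0"
  proof -
    have "(\<Sum>v\<in>V. c v)\<^sup>2 \<le> real (card V) * S"
      using sum_squared_le_sum_of_squares[of c V] by (simp add: S_def mult.commute)
    then have "t * (\<Sum>v\<in>V. c v)\<^sup>2 \<le> (t * real (card V)) * S"
      using t(1) by (simp add: mult_left_mono mult.assoc)
    also have "\<dots> \<le> (1 + t) * S"
      using t(2) by (intro mult_right_mono) (auto simp: S_def sum_nonneg algebra_simps)
    finally show ?thesis by simp
  qed
  finally show "0 \<le> (\<Sum>u\<in>V. \<Sum>v\<in>V. c u * c v * (if u = v then 1 else - t))" .
qed simp

text \<open>The \<open>LEAST\<close> in \<open>chi_vec\<close> can be used only once a minimum
  exists. Gram matrices for values of \<kappa> tending to the infimum have entries in [-1, 1]; a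
  subsequence converges entrywise, and all the conditions on them are closed.\<close>

lemma chi_vec_attained:
  assumes G: "simple_graph V E"
  shows "chi_vec V E \<ge> 2 \<and> (\<exists>d x. vector_colouring (chi_vec V E) d x V E)"
proof -
  have fin: "finite V" using G by (simp add: simple_graph_def)
  define S where "S = {\<kappa>::real. \<kappa> \<ge> 2 \<and> (\<exists>d x. vector_colouring \<kappa> d x V E)}"
  \<comment> \<open>The value given by the simplex; the maximum with 2 keeps it admissible when
    \<open>V\<close> has at most one vertex.\<close>
  define m where "m = max 2 (real (card V))"
  have "m \<in> S"
  proof -
    have "psd_on V (\<lambda>u v. if u = v then 1 else - (1 / (m - 1)))"
      by (rule simplex_psd_on[OF fin]) (auto simp: m_def field_simps)
    then have "\<exists>d x. vector_colouring m d x V E"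
      unfolding vector_colouring_iff_psd[OF fin] by (intro exI conjI) auto
    then show ?thesis by (simp add: S_def m_def)
  qed
  then have ne: "S \<noteq> {}" by blast
  have bdd: "bdd_below S" by (rule bdd_belowI[of _ 2]) (simp add: S_def)
  define k where "k = Inf S"
  have k2: "2 \<le> k" unfolding k_def by (rule cInf_greatest[OF ne]) (simp add: S_def)
  have "\<exists>\<kappa>\<in>S. \<kappa> < k + 1 / real (Suc n)" for n
    using cInf_lessD[OF ne, of "k + 1 / real (Suc n)"] by (auto simp: k_def)
  then obtain \<kappa> where \<kappa>: "\<And>n. \<kappa> n \<in> S" "\<And>n. \<kappa> n < k + 1 / real (Suc n)" by metis
  have k_le: "k \<le> \<kappa> n" for n unfolding k_def by (rule cInf_lower[OF \<kappa>(1) bdd])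
  have \<kappa>_lim: "\<kappa> \<longlonglongrightarrow> k"
  proof (rule tendsto_sandwich[where f = "\<lambda>_. k" and h = "\<lambda>n. k + 1 / real (Suc n)"])
    show "(\<lambda>n. k + 1 / real (Suc n)) \<longlonglongrightarrow> k"
      using tendsto_add[OF tendsto_const LIMSEQ_inverse_real_of_nat, of k] by (simp add: inverse_eq_divide)
    show "\<forall>\<^sub>F n in sequentially. \<kappa> n \<le> k + 1 / real (Suc n)"
      using \<kappa>(2) by (intro always_eventually allI less_imp_le)
    show "\<forall>\<^sub>F n in sequentially. k \<le> \<kappa> n" using k_le by simp
  qed simp
  have "\<forall>n. \<exists>g. psd_on V g \<and> (\<forall>v\<in>V. g v v = 1) \<and>
      (\<forall>u\<in>V. \<forall>v\<in>V. u \<noteq> v \<and> {u, v} \<in> E \<longrightarrow> g u v \<le> - (1 / (\<kappa> n - 1)))"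
    using \<kappa>(1) by (simp add: S_def vector_colouring_iff_psd[OF fin])
  from choice[OF this] obtain g where "\<forall>n. psd_on V (g n) \<and> (\<forall>v\<in>V. g n v v = 1) \<and>
      (\<forall>u\<in>V. \<forall>v\<in>V. u \<noteq> v \<and> {u, v} \<in> E \<longrightarrow> g n u v \<le> - (1 / (\<kappa> n - 1)))" ..
  then have g: "\<And>n. psd_on V (g n)" "\<And>n v. v \<in> V \<Longrightarrow> g n v v = 1"
    "\<And>n u v. u \<in> V \<Longrightarrow> v \<in> V \<Longrightarrow> u \<noteq> v \<Longrightarrow> {u, v} \<in> E \<Longrightarrow> g n u v \<le> - (1 / (\<kappa> n - 1))"
    by auto
  have bound: "\<bar>g n u v\<bar> \<le> 1" if "u \<in> V" "v \<in> V" for n u v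
  proof (cases "u = v")
    case False
    \<comment> \<open>With unit diagonal, the coefficients 1 and -1 give
      \<open>0 \<le> 2 + 2 * g n u v\<close> and \<open>0 \<le> 2 - 2 * g n u v\<close>.\<close>
    from psd_on_pair_form[OF fin g(1)[of n] that this, of 1] psd_on_pair_form[OF fin g(1)[of n] that this, of "-1"]
    show ?thesis using g(2)[OF that(1), of n] g(2)[OF that(2), of n] by (simp add: abs_le_iff)
  qed (use g(2) that in simp)
  have "\<exists>r. strict_mono r \<and> (\<forall>p\<in>V \<times> V. \<exists>l. (\<lambda>n. case_prod (g (r n)) p) \<longlonglongrightarrow> l)"
    by (rule finite_simultaneous_subseq[where B = 1 and f = "\<lambda>n. case_prod (g n)"]) (use fin bound in \<open>auto simp: split_beta\<close>)
  then obtain r where r: "strict_mono r"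
    and lim: "\<forall>p\<in>V \<times> V. \<exists>l. (\<lambda>n. case_prod (g (r n)) p) \<longlonglongrightarrow> l"
    by blast
  define h where "h u v = lim (\<lambda>n. g (r n) u v)" for u v
  have h: "(\<lambda>n. g (r n) u v) \<longlonglongrightarrow> h u v" if "u \<in> V" "v \<in> V" for u v
    using bspec[OF lim, of "(u, v)"] that
    by (simp add: h_def convergent_def flip: convergent_LIMSEQ_iff)
  have "psd_on V h"
    unfolding psd_on_def
  proof (intro conjI ballI allI)
    show "h u v = h v u" if "u \<in> V" "v \<in> V" for u v
    proof -
      have "g (r n) u v = g (r n) v u" for n using psd_on_sym[OF g(1) that] .
      then show ?thesis using h[OF that] h[OF that(2,1)] LIMSEQ_unique by simp
    qed
    fix c :: "'a \<Rightarrow> real"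
    have "(\<lambda>n. \<Sum>u\<in>V. \<Sum>v\<in>V. c u * c v * g (r n) u v) \<longlonglongrightarrow> (\<Sum>u\<in>V. \<Sum>v\<in>V. c u * c v * h u v)"
      by (intro tendsto_intros h)
    then show "0 \<le> (\<Sum>u\<in>V. \<Sum>v\<in>V. c u * c v * h u v)"
      by (rule LIMSEQ_le_const) (use psd_on_nonneg[OF g(1)] in blast)
  qed
  moreover have "h v v = 1" if "v \<in> V" for v
    using h[OF that that] g(2)[OF that] LIMSEQ_unique[OF _ tendsto_const] by simp
  moreover have "h u v \<le> - (1 / (k - 1))" if "u \<in> V" "v \<in> V" "u \<noteq> v" "{u, v} \<in> E" for u v
  proof (rule LIMSEQ_le[OF h[OF that(1,2)]])
    \<comment> \<open>The denominators tend to \<open>k - 1\<close>, which is at least 1, so the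
      reciprocals converge too.\<close>
    have "(\<lambda>n. \<kappa> (r n)) \<longlonglongrightarrow> k" using LIMSEQ_subseq_LIMSEQ[OF \<kappa>_lim r] by (simp add: o_def)
    then show "(\<lambda>n. - (1 / (\<kappa> (r n) - 1))) \<longlonglongrightarrow> - (1 / (k - 1))"
      using k2 by (intro tendsto_intros) auto
  qed (use g(3) that in blast)
  ultimately have "\<exists>d x. vector_colouring k d x V E"
    unfolding vector_colouring_iff_psd[OF fin] by blast
  then have "k \<in> S" using k2 by (simp add: S_def)
  moreover have "chi_vec V E = k"
    unfolding chi_vec_def
  proof (rule Least_equality)
    show "k \<le> y" if "2 \<le> y \<and> (\<exists>d x. vector_colouring y d x V E)" for y
      unfolding k_def by (rule cInf_lower[OF _ bdd]) (use that in \<open>simp add: S_def\<close>)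
  qed (use \<open>k \<in> S\<close> in \<open>simp add: S_def\<close>)
  ultimately show ?thesis by (simp add: S_def)
qed

section \<open>Gaussian vectors\<close>

abbreviation gauss_vec :: "nat \<Rightarrow> (nat \<Rightarrow> real) measure" where
  "gauss_vec d \<equiv> Pi\<^sub>M {..<d} (\<lambda>_. std_normal_distribution)"

lemma prob_space_gauss_vec: "prob_space (gauss_vec d)"
  by (intro prob_space_PiM real_dist_normal_dist[THEN real_distribution.axioms(1)])

lemma measurable_gauss_vec [measurable]:
  "(\<lambda>g. \<Sum>i<d. a i * g i) \<in> borel_measurable (gauss_vec d)"
proof -
  have "(\<lambda>g. g i) \<in> borel_measurable (gauss_vec d)" if "i < d" for i
    using measurable_component_singleton[of i "{..<d}" "\<lambda>_. std_normal_distribution"] that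
    by simp
  then show ?thesis
    by (intro borel_measurable_sum borel_measurable_times) auto
qed

text \<open>This is the real part of the characteristic function, which factors over the independent
  coordinates.\<close>

lemma integral_cos_gauss_vec:
  "(\<integral>g. cos (\<Sum>i<d. a i * g i) \<partial>gauss_vec d) = exp (- (\<Sum>i<d. (a i)\<^sup>2) / 2)"
proof -
  interpret N: prob_space std_normal_distribution
    by (intro real_dist_normal_dist[THEN real_distribution.axioms(1)])
  interpret P: product_prob_space "\<lambda>_::nat. std_normal_distribution" "{..<d}" ..
  have int1: "integrable std_normal_distribution (\<lambda>x. iexp (a i * x))" for i
    by (intro N.integrable_iexp) auto
  have "(\<integral>g. (\<Prod>i<d. iexp (a i * g i)) \<partial>gauss_vec d) = (\<Prod>i<d. \<integral>x. iexp (a i * x) \<partial>std_normal_distribution)"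
    by (rule P.product_integral_prod) (use int1 in auto)
  also have "\<dots> = (\<Prod>i<d. complex_of_real (exp (- (a i)\<^sup>2 / 2)))"
    using fun_cong[OF char_std_normal_distribution] by (simp add: char_def)
  also have "\<dots> = complex_of_real (exp (- (\<Sum>i<d. (a i)\<^sup>2) / 2))"
    by (simp add: exp_sum[symmetric] sum_divide_distrib sum_negf flip: of_real_prod)
  finally have eq: "(\<integral>g. iexp (\<Sum>i<d. a i * g i) \<partial>gauss_vec d) = complex_of_real (exp (- (\<Sum>i<d. (a i)\<^sup>2) / 2))"
    by (simp add: exp_sum[symmetric] sum_distrib_left)
  have "integrable (gauss_vec d) (\<lambda>g. iexp (\<Sum>i<d. a i * g i))"
    by (intro P.integrable_iexp measurable_gauss_vec) auto
  from integral_Re[OF this] eq show ?thesis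
    by (simp add: Re_exp)
qed

lemma integrable_bounded_gauss_vec:
  fixes f :: "(nat \<Rightarrow> real) \<Rightarrow> real"
  assumes "f \<in> borel_measurable (gauss_vec d)" "\<And>g. \<bar>f g\<bar> \<le> B"
  shows "integrable (gauss_vec d) f"
proof -
  interpret prob_space "gauss_vec d" by (rule prob_space_gauss_vec)
  show ?thesis using assms by (intro integrable_const_bound[of _ B]) auto
qed

text \<open>A product of sines is half a difference of cosines of linear forms in \<open>g\<close>.
  Their variances differ only in the sign of the term containing the inner product, whence the
  \<open>sinh\<close>.\<close>

lemma integral_sin_sin_gauss_vec:
  assumes "(\<Sum>i<d. (x i)\<^sup>2) = 1" "(\<Sum>i<d. (y i)\<^sup>2) = 1"
  shows "(\<integral>g. sin (s * (\<Sum>i<d. x i * g i)) * sin (t * (\<Sum>i<d. y i * g i)) \<partial>gauss_vec d)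
    = exp (- s\<^sup>2 / 2) * exp (- t\<^sup>2 / 2) * sinh (s * t * (\<Sum>i<d. x i * y i))"
proof -
  define \<rho> where "\<rho> = (\<Sum>i<d. x i * y i)"
  let ?A = "\<lambda>e g. cos (\<Sum>i<d. (s * x i + e * t * y i) * g i)"
  have sq: "(\<Sum>i<d. (s * x i + e * t * y i)\<^sup>2) = s\<^sup>2 + t\<^sup>2 + 2 * e * s * t * \<rho>" if "e\<^sup>2 = 1" for e
  proof -
    have "(\<Sum>i<d. (s * x i + e * t * y i)\<^sup>2)
      = s\<^sup>2 * (\<Sum>i<d. (x i)\<^sup>2) + e\<^sup>2 * t\<^sup>2 * (\<Sum>i<d. (y i)\<^sup>2) + 2 * e * s * t * \<rho>"
      unfolding \<rho>_def sum_distrib_left sum.distrib[symmetric]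
      by (intro sum.cong refl) (simp add: power2_eq_square algebra_simps)
    then show ?thesis using assms that by simp
  qed
  have int: "integrable (gauss_vec d) (?A e)" for e
    by (intro integrable_bounded_gauss_vec[where B = 1]) simp_all
  have "sin (s * (\<Sum>i<d. x i * g i)) * sin (t * (\<Sum>i<d. y i * g i)) = (?A (-1) g - ?A 1 g) / 2" for g
    by (simp add: sin_times_sin sum_distrib_left algebra_simps flip: sum_subtractf sum.distrib)
  then have "(\<integral>g. sin (s * (\<Sum>i<d. x i * g i)) * sin (t * (\<Sum>i<d. y i * g i)) \<partial>gauss_vec d)
    = ((\<integral>g. ?A (-1) g \<partial>gauss_vec d) - (\<integral>g. ?A 1 g \<partial>gauss_vec d)) / 2"
    by (simp only: Bochner_Integration.integral_diff[OF int int] integral_divide_zero)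
  also have "\<dots> = (exp (- (s\<^sup>2 + t\<^sup>2 - 2 * s * t * \<rho>) / 2) - exp (- (s\<^sup>2 + t\<^sup>2 + 2 * s * t * \<rho>) / 2)) / 2"
    using sq[of 1] sq[of "-1"] by (simp only: integral_cos_gauss_vec) simp
  also have "\<dots> = exp (- s\<^sup>2 / 2) * exp (- t\<^sup>2 / 2) * sinh (s * t * \<rho>)"
    by (simp add: sinh_field_def exp_add[symmetric] exp_minus field_simps)
  finally show ?thesis by (simp add: \<rho>_def)
qed

section \<open>Square waves\<close>

text \<open>The Cayley transform (1 + z) / (1 - z) maps the open unit disc into the right
  half-plane, where the argument is below pi / 2 in absolute value. Both logarithms have such
  arguments, so their difference is the principal logarithm of the quotient.\<close>

lemma abs_Im_Ln_quotient_less: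
  assumes "cmod z < 1"
  shows "\<bar>Im (Ln (1 + z) - Ln (1 - z))\<bar> < pi / 2"
proof -
  have re: "\<bar>Re z\<bar> < 1" using assms abs_Re_le_cmod[of z] by linarith
  then have nz: "1 + z \<noteq> 0" "1 - z \<noteq> 0" by (auto simp: complex_eq_iff)
  have arg: "\<bar>Im (Ln (1 + z))\<bar> < pi / 2" "\<bar>Im (Ln (1 - z))\<bar> < pi / 2"
    using re by (intro Re_Ln_pos_lt_imp; simp)+
  have "Ln ((1 + z) / (1 - z)) = Ln (1 + z) - Ln (1 - z)"
  proof -
    have "exp (Ln (1 + z) - Ln (1 - z)) = (1 + z) / (1 - z)"
      using nz by (simp add: exp_diff)
    moreover have "\<bar>Im (Ln (1 + z) - Ln (1 - z))\<bar> < pi" using arg by auto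
    ultimately show ?thesis by (metis Ln_exp abs_less_iff minus_less_iff less_imp_le)
  qed
  moreover have "0 < Re ((1 + z) / (1 - z))"
  proof -
    have "(cmod z)\<^sup>2 < 1" using assms by (simp add: abs_square_less_1)
    then have "0 < Re ((1 + z) * cnj (1 - z))"
      unfolding cmod_power2 by (simp add: algebra_simps power2_eq_square)
    moreover have "(1 + z) / (1 - z) = (1 + z) * cnj (1 - z) / of_real ((cmod (1 - z))\<^sup>2)"
      using nz by (simp add: complex_div_cnj[of "1 + z" "1 - z"])
    ultimately show ?thesis using nz by (simp only: Re_divide_of_real) auto
  qed
  ultimately show ?thesis using Re_Ln_pos_lt_imp by metis
qed

text \<open>The power series of artanh: subtracting the logarithm series at \<open>z\<close> and
  \<open>- z\<close> cancels the even terms.\<close>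

lemma sums_odd_Ln:
  assumes "cmod z < 1"
  shows "(\<lambda>j. z ^ (2 * j + 1) / of_nat (2 * j + 1)) sums ((Ln (1 + z) - Ln (1 - z)) / 2)"
proof -
  let ?f = "\<lambda>n. (z ^ n - (- z) ^ n) / of_nat n / 2"
  have "(\<lambda>n. (- ((-z) ^ n) / of_nat n - - ((-(-z)) ^ n) / of_nat n) / 2) sums ((Ln (1 + z) - Ln (1 + (- z))) / 2)"
    using assms by (intro sums_divide sums_diff Ln_series') auto
  then have "?f sums ((Ln (1 + z) - Ln (1 - z)) / 2)"
    by (simp add: diff_divide_distrib)
  moreover have "(\<lambda>j. ?f (2 * j + 1)) sums S \<longleftrightarrow> ?f sums S" for S
  proof (rule sums_mono_reindex)
    show "strict_mono (\<lambda>j::nat. 2 * j + 1)" by (auto simp: strict_mono_def)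
    show "?f n = 0" if "n \<notin> range (\<lambda>j. 2 * j + 1)" for n
    proof -
      have "even n" using that by (metis oddE rangeI)
      then show ?thesis by simp
    qed
  qed
  ultimately have "(\<lambda>j. ?f (2 * j + 1)) sums ((Ln (1 + z) - Ln (1 - z)) / 2)" by blast
  moreover have "?f (2 * j + 1) = z ^ (2 * j + 1) / of_nat (2 * j + 1)" for j
  proof -
    have "(- z) ^ (2 * j + 1) = - (z ^ (2 * j + 1))" by (rule power_minus_odd) simp
    moreover have "(x + x) / y / 2 = x / y" for x y :: complex by simp
    ultimately show ?thesis by (simp only: diff_minus_eq_add)
  qed
  ultimately show ?thesis by simp
qed

text \<open>For \<open>r = 1\<close> this would be a partial sum of the Fourier series of \<open>sgn (sin \<theta>)\<close>; the damping \<open>r < 1\<close>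
  avoids the Gibbs overshoot.\<close>
definition sq_wave :: "real \<Rightarrow> nat \<Rightarrow> real \<Rightarrow> real" where
  "sq_wave r N \<theta> = (4 / pi) * (\<Sum>j<N. r ^ (2 * j + 1) * sin (real (2 * j + 1) * \<theta>) / real (2 * j + 1))"

text \<open>The infinite series is the imaginary part of artanh at \<open>r * cis \<theta>\<close>,
  hence at most pi / 4 in absolute value, and the factor 4 / pi turns this into 1. The remaining
  summand bounds the truncated tail.\<close>

lemma abs_sq_wave_le:
  assumes r: "0 < r" "r < 1"
  shows "\<bar>sq_wave r N \<theta>\<bar> \<le> 1 + (4 / pi) * (r ^ N / (1 - r))"
proof -
  define a where "a j = r ^ (2 * j + 1) * sin (real (2 * j + 1) * \<theta>) / real (2 * j + 1)" for j
  define z where "z = of_real r * cis \<theta>"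
  have z: "cmod z < 1" using r by (simp add: z_def norm_mult)
  define S where "S = Im (Ln (1 + z) - Ln (1 - z)) / 2"
  have "a j = Im (z ^ (2 * j + 1) / of_nat (2 * j + 1))" for j
  proof -
    have "z ^ (2 * j + 1) = of_real (r ^ (2 * j + 1)) * cis (real (2 * j + 1) * \<theta>)"
      unfolding z_def power_mult_distrib by (simp only: of_real_power Complex.DeMoivre)
    then show ?thesis unfolding a_def by (simp only: Im_divide_of_nat) simp
  qed
  then have aS: "a sums S"
    using sums_Im[OF sums_odd_Ln[OF z]] unfolding S_def
    by (metis (no_types, lifting) ext Im_divide_numeral)
  have "\<bar>S\<bar> \<le> pi / 4" using abs_Im_Ln_quotient_less[OF z] by (simp add: S_def)
  have bound: "norm (a (j + N)) \<le> r ^ N * r ^ j" for j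
  proof -
    \<comment> \<open>The sine and the denominator are dropped and the exponent is lowered, leaving
      a geometric series.\<close>
    have "norm (a (j + N)) \<le> r ^ (2 * (j + N) + 1) * 1 / 1"
      unfolding a_def real_norm_def abs_mult abs_divide
      by (intro frac_le mult_mono) (use r in auto)
    also have "\<dots> = r ^ (2 * (j + N) + 1)" by simp
    also have "\<dots> \<le> r ^ (N + j)" using r by (intro power_decreasing) auto
    finally show ?thesis by (simp add: power_add)
  qed
  have geo: "(\<lambda>j. r ^ N * r ^ j) sums (r ^ N * (1 / (1 - r)))"
    using r by (intro sums_mult geometric_sums) auto
  have "norm (\<Sum>j. a (j + N)) \<le> (\<Sum>j. r ^ N * r ^ j)"
    by (rule norm_suminf_le[OF bound sums_summable[OF geo]])
  then have tail: "\<bar>\<Sum>j. a (j + N)\<bar> \<le> r ^ N / (1 - r)"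
    using sums_unique[OF geo] by simp
  have "(\<Sum>j<N. a j) = S - (\<Sum>j. a (j + N))"
    using suminf_split_initial_segment[OF sums_summable[OF aS], of N] sums_unique[OF aS] by simp
  then have "\<bar>\<Sum>j<N. a j\<bar> \<le> pi / 4 + r ^ N / (1 - r)"
    using tail \<open>\<bar>S\<bar> \<le> pi / 4\<close> by linarith
  then have "(4 / pi) * \<bar>\<Sum>j<N. a j\<bar> \<le> (4 / pi) * (pi / 4 + r ^ N / (1 - r))"
    by (intro mult_left_mono) auto
  then show ?thesis unfolding sq_wave_def a_def[symmetric] by (simp add: abs_mult distrib_left)
qed

text \<open>For a decreasing integrand, left endpoints overestimate the integral on each interval of
  length \<open>2 * h\<close> starting at an odd multiple of \<open>h\<close>. The initial interval
  of length \<open>h\<close> costs at most \<open>h\<close>, and \<epsilon> pays for stopping at a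
  finite \<open>N\<close>.\<close>

lemma exists_gauss_sum_ge:
  assumes h: "0 < h" and "0 < \<epsilon>"
  shows "\<exists>N. sqrt pi / 2 - h - \<epsilon> \<le> 2 * h * (\<Sum>j<N. exp (- (real (2 * j + 1) * h)\<^sup>2))"
proof -
  define f where "f = (\<lambda>x::real. exp (- x\<^sup>2))"
  \<comment> \<open>The integral of \<open>f\<close> from 0 to \<open>y\<close>, written as a
    truncation of the half-line integral so that its limit is immediate.\<close>
  define G where "G = (\<lambda>y. \<integral>x. indicator {..y} x *\<^sub>R (indicator {0..} x *\<^sub>R f x) \<partial>lborel)"
  have int: "integrable lborel (\<lambda>x. indicator {0..} x *\<^sub>R f x)"
    and val: "(\<integral>x. indicator {0..} x *\<^sub>R f x \<partial>lborel) = sqrt pi / 2"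
    using gaussian_moment_0 by (auto simp: has_bochner_integral_iff f_def)
  have lim: "(G \<longlongrightarrow> sqrt pi / 2) at_top"
    unfolding G_def val[symmetric] by (rule tendsto_integral_at_top[OF _ int]) simp
  have int_step: "(\<integral>x. indicator {a<..b} x * c \<partial>lborel) = (b - a) * c"
    and int_step': "integrable lborel (\<lambda>x. indicator {a<..b} x * c)" if "a \<le> b" for a b c :: real
    using that by auto
  have int_G: "integrable lborel (\<lambda>x. indicator {..y} x *\<^sub>R (indicator {0..} x *\<^sub>R f x))" for y
    by (intro integrable_mult_indicator int) simp
  have step: "G b \<le> G a + (b - a) * f a" if "0 \<le> a" "a \<le> b" for a b
  proof -
    have "G b \<le> (\<integral>x. indicator {..a} x *\<^sub>R (indicator {0..} x *\<^sub>R f x) + indicator {a<..b} x * f a \<partial>lborel)"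
      unfolding G_def
    proof (intro integral_mono Bochner_Integration.integrable_add int_G int_step' that)
      show "indicator {..b} x *\<^sub>R (indicator {0..} x *\<^sub>R f x)
        \<le> indicator {..a} x *\<^sub>R (indicator {0..} x *\<^sub>R f x) + indicator {a<..b} x * f a" for x
        using that by (auto simp: indicator_def f_def abs_le_square_iff[symmetric])
    qed
    also have "\<dots> = G a + (b - a) * f a"
      unfolding G_def by (subst Bochner_Integration.integral_add) (use that int_G int_step int_step' in auto)
    finally show ?thesis .
  qed
  have G0: "G 0 \<le> 0"
  proof -
    have "G 0 = (\<integral>x. indicator {0::real} x * f 0 \<partial>lborel)"
      unfolding G_def by (intro Bochner_Integration.integral_cong) (auto simp: indicator_def)
    then show ?thesis by simp
  qed
  have up: "G (real (2 * N + 1) * h) \<le> h + 2 * h * (\<Sum>j<N. f (real (2 * j + 1) * h))" for N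
  proof (induction N)
    case 0
    show ?case using step[of 0 h] G0 h by (simp add: f_def)
  next
    case (Suc N)
    show ?case
      using step[of "real (2 * N + 1) * h" "real (2 * Suc N + 1) * h"] Suc h
      by (simp add: algebra_simps)
  qed
  have "filterlim (\<lambda>N. real (2 * N + 1) * h) at_top sequentially"
    using h by real_asymp
  from filterlim_compose[OF lim this]
  have "\<forall>\<^sub>F N in sequentially. sqrt pi / 2 - \<epsilon> < G (real (2 * N + 1) * h)"
    using \<open>0 < \<epsilon>\<close> by (intro order_tendstoD) auto
  then obtain N where "sqrt pi / 2 - \<epsilon> < G (real (2 * N + 1) * h)"
    by (auto simp: eventually_sequentially)
  then show ?thesis using up[of N] unfolding f_def by (intro exI[of _ N]) linarith
qed

section \<open>The rounding bound\<close>

lemma le_sinh_real: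
  fixes z :: real
  assumes "0 \<le> z"
  shows "z \<le> sinh z"
proof -
  have "sinh 0 - 0 \<le> sinh z - z"
  proof (rule DERIV_nonneg_imp_nondecreasing[OF assms, of "\<lambda>z. sinh z - z"])
    fix y :: real
    have "((\<lambda>z. sinh z - z) has_real_derivative (cosh y - 1)) (at y)"
      by (auto intro!: derivative_eq_intros)
    moreover have "0 \<le> cosh y - 1" using cosh_real_ge_1[of y] by simp
    ultimately show "\<exists>D. ((\<lambda>z. sinh z - z) has_real_derivative D) (at y) \<and> 0 \<le> D" by blast
  qed
  then show ?thesis by simp
qed

text \<open>This is \<open>E [Z \<phi> (Z)]\<close> for \<open>\<phi> u = sq_wave r N (\<delta> * u)\<close> and a standard normal \<open>Z\<close>.\<close>
definition sq_wave_coeff :: "real \<Rightarrow> nat \<Rightarrow> real \<Rightarrow> real" where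
  "sq_wave_coeff r N \<delta> = (4 / pi) * (\<Sum>j<N. r ^ (2 * j + 1) * \<delta> * exp (- (real (2 * j + 1) * \<delta>)\<^sup>2 / 2))"

lemma measurable_sq_wave_gauss_vec [measurable]:
  "(\<lambda>g. sq_wave r N (\<delta> * (\<Sum>i<d. x i * g i))) \<in> borel_measurable (gauss_vec d)"
  unfolding sq_wave_def by measurable

text \<open>Expanding both waves gives a double sum with nonnegative weights, so \<open>sinh\<close>
  can be replaced by its argument term by term. What remains factors into \<rho> times a
  square.\<close>

lemma integral_sq_wave_gauss_vec_le:
  assumes r: "0 < r" "r < 1" and \<delta>: "0 < \<delta>"
    and x: "(\<Sum>i<d. (x i)\<^sup>2) = 1" and y: "(\<Sum>i<d. (y i)\<^sup>2) = 1"
    and \<rho>: "(\<Sum>i<d. x i * y i) \<le> 0"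
  shows "(\<integral>g. sq_wave r N (\<delta> * (\<Sum>i<d. x i * g i)) * sq_wave r N (\<delta> * (\<Sum>i<d. y i * g i)) \<partial>gauss_vec d)
    \<le> (\<Sum>i<d. x i * y i) * (sq_wave_coeff r N \<delta>)\<^sup>2"
proof -
  define \<rho> where "\<rho> = (\<Sum>i<d. x i * y i)"
  define k where "k j = real (2 * j + 1)" for j
  define a where "a j = (4 / pi) * r ^ (2 * j + 1) / k j" for j
  define e where "e j = exp (- (k j * \<delta>)\<^sup>2 / 2)" for j
  have kpos: "0 < k j" for j by (simp add: k_def)
  have apos: "0 \<le> a j" for j using r kpos[of j] by (simp add: a_def)
  have epos: "0 \<le> e j" for j by (simp add: e_def)
  have wave: "sq_wave r N (\<delta> * u) = (\<Sum>j<N. a j * sin (k j * \<delta> * u))" for u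
    unfolding sq_wave_def a_def k_def[symmetric] sum_distrib_left
    by (intro sum.cong refl) (simp add: mult.assoc)
  have coeff: "sq_wave_coeff r N \<delta> = (\<Sum>j<N. a j * e j * (k j * \<delta>))"
    unfolding sq_wave_coeff_def k_def[symmetric] a_def e_def sum_distrib_left
    using kpos by (intro sum.cong refl) (simp add: less_imp_neq[symmetric])
  let ?s = "\<lambda>j g. sin (k j * \<delta> * (\<Sum>i<d. x i * g i))"
  let ?t = "\<lambda>l g. sin (k l * \<delta> * (\<Sum>i<d. y i * g i))"
  have int: "integrable (gauss_vec d) (\<lambda>g. ?s j g * ?t l g)" for j l
    by (intro integrable_bounded_gauss_vec[where B = 1])
       (auto simp: abs_mult intro!: mult_le_one)
  have "(\<integral>g. sq_wave r N (\<delta> * (\<Sum>i<d. x i * g i)) * sq_wave r N (\<delta> * (\<Sum>i<d. y i * g i)) \<partial>gauss_vec d)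
    = (\<integral>g. (\<Sum>j<N. \<Sum>l<N. a j * a l * (?s j g * ?t l g)) \<partial>gauss_vec d)"
    unfolding wave sum_product
    by (intro Bochner_Integration.integral_cong sum.cong refl) (simp only: mult_ac)
  also have "\<dots> = (\<Sum>j<N. \<Sum>l<N. a j * a l * (\<integral>g. ?s j g * ?t l g \<partial>gauss_vec d))"
    using int by (simp add: Bochner_Integration.integral_sum)
  also have "\<dots> = (\<Sum>j<N. \<Sum>l<N. a j * a l * (e j * e l * sinh (k j * \<delta> * (k l * \<delta>) * \<rho>)))"
    by (simp only: integral_sin_sin_gauss_vec[OF x y] e_def \<rho>_def)
  also have "\<dots> \<le> (\<Sum>j<N. \<Sum>l<N. a j * a l * (e j * e l * (k j * \<delta> * (k l * \<delta>) * \<rho>)))"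
  proof (intro sum_mono mult_left_mono)
    fix j l
    have "0 \<le> - (k j * \<delta> * (k l * \<delta>) * \<rho>)"
      using kpos[of j] kpos[of l] \<delta> \<rho> by (simp add: \<rho>_def mult_nonneg_nonpos)
    \<comment> \<open>Oddness of \<open>sinh\<close> reverses the inequality for nonpositive
      arguments.\<close>
    from le_sinh_real[OF this] show "sinh (k j * \<delta> * (k l * \<delta>) * \<rho>) \<le> k j * \<delta> * (k l * \<delta>) * \<rho>"
      by simp
  qed (use apos epos in auto)
  also have "\<dots> = \<rho> * ((\<Sum>j<N. a j * e j * (k j * \<delta>)) * (\<Sum>l<N. a l * e l * (k l * \<delta>)))"
    unfolding sum_product unfolding sum_distrib_left by (simp add: mult_ac)
  finally show ?thesis by (simp add: coeff \<rho>_def power2_eq_square)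
qed

lemma cut_bound_sq_wave:
  fixes x :: "'a \<Rightarrow> nat \<Rightarrow> real"
  assumes G: "simple_graph V E" and r: "0 < r" "r < 1" and \<delta>: "0 < \<delta>" and t: "0 \<le> t"
    and unit: "\<And>v. v \<in> V \<Longrightarrow> (\<Sum>i<d. (x v i)\<^sup>2) = 1"
    and edge: "\<And>u v. u \<in> V \<Longrightarrow> v \<in> V \<Longrightarrow> u \<noteq> v \<Longrightarrow> {u, v} \<in> E \<Longrightarrow> (\<Sum>i<d. x u i * x v i) \<le> - t"
  shows "(real (card E) - 2 * real (mc V E)) * (1 + (4 / pi) * (r ^ N / (1 - r)))\<^sup>2
    \<le> - (t * real (card E) * (sq_wave_coeff r N \<delta>)\<^sup>2)"
proof -
  define B where "B = real (card E) - 2 * real (mc V E)"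
  define M where "M = 1 + (4 / pi) * (r ^ N / (1 - r))"
  have M: "1 \<le> M" using r by (simp add: M_def)
  interpret prob_space "gauss_vec d" by (rule prob_space_gauss_vec)
  \<comment> \<open>Division by \<open>M\<close> brings the wave into [-1, 1]; \<open>p g v\<close>
    acts as the conditional mean of the sign of \<open>v\<close> given \<open>g\<close>.\<close>
  define p where "p g v = sq_wave r N (\<delta> * (\<Sum>i<d. x v i * g i)) / M" for g v
  have pbound: "\<bar>p g v\<bar> \<le> 1" for g v
    using abs_sq_wave_le[OF r, of N "\<delta> * (\<Sum>i<d. x v i * g i)"] M
    unfolding p_def M_def[symmetric] by (simp add: abs_divide)
  have fin: "finite e" if "e \<in> E" for e
    using G that by (auto simp: simple_graph_def intro: finite_subset)
  have finV: "finite V" using G by (simp add: simple_graph_def)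
  \<comment> \<open>The cube bound holds for every \<open>g\<close> separately, which replaces the
    second random choice of signs.\<close>
  have le: "B \<le> (\<Sum>e\<in>E. \<Prod>v\<in>e. p g v)" for g
    unfolding B_def
    by (rule sum_prod_cube_ge[of V]) (use sum_prod_signs_ge[OF G] finV fin pbound in auto)
  have pm [measurable]: "(\<lambda>g. p g v) \<in> borel_measurable (gauss_vec d)" for v
    unfolding p_def by measurable
  have int: "integrable (gauss_vec d) (\<lambda>g. \<Prod>v\<in>e. p g v)" for e
  proof (rule integrable_bounded_gauss_vec[where B = 1])
    show "\<bar>\<Prod>v\<in>e. p g v\<bar> \<le> 1" for g
      unfolding abs_prod by (rule prod_le_1) (use pbound in auto)
  qed simp
  have edge_int: "(\<integral>g. (\<Prod>v\<in>e. p g v) \<partial>gauss_vec d) \<le> - t * (sq_wave_coeff r N \<delta>)\<^sup>2 / M\<^sup>2" if "e \<in> E" for e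
    using G that
  proof (rule simple_graph_edge)
    fix u v assume e: "e = {u, v}" "u \<noteq> v" "u \<in> V" "v \<in> V"
    let ?I = "\<integral>g. sq_wave r N (\<delta> * (\<Sum>i<d. x u i * g i)) * sq_wave r N (\<delta> * (\<Sum>i<d. x v i * g i)) \<partial>gauss_vec d"
    have \<rho>: "(\<Sum>i<d. x u i * x v i) \<le> - t" using edge e that by simp
    then have "?I \<le> (\<Sum>i<d. x u i * x v i) * (sq_wave_coeff r N \<delta>)\<^sup>2"
      using e t by (intro integral_sq_wave_gauss_vec_le r \<delta> unit) auto
    also have "\<dots> \<le> - t * (sq_wave_coeff r N \<delta>)\<^sup>2"
      by (rule mult_right_mono[OF \<rho>]) simp
    finally have "?I / M\<^sup>2 \<le> - t * (sq_wave_coeff r N \<delta>)\<^sup>2 / M\<^sup>2"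
      by (rule divide_right_mono) simp
    then show ?thesis using e by (simp add: p_def power2_eq_square)
  qed
  have "B = (\<integral>g. B \<partial>gauss_vec d)" by (simp add: prob_space)
  also have "\<dots> \<le> (\<integral>g. (\<Sum>e\<in>E. \<Prod>v\<in>e. p g v) \<partial>gauss_vec d)"
    by (intro integral_mono Bochner_Integration.integrable_sum int le) simp
  also have "\<dots> = (\<Sum>e\<in>E. \<integral>g. (\<Prod>v\<in>e. p g v) \<partial>gauss_vec d)"
    by (intro Bochner_Integration.integral_sum int)
  also have "\<dots> \<le> (\<Sum>e\<in>E. - t * (sq_wave_coeff r N \<delta>)\<^sup>2 / M\<^sup>2)"
    by (intro sum_mono edge_int)
  finally have "B \<le> - (t * real (card E) * (sq_wave_coeff r N \<delta>)\<^sup>2) / M\<^sup>2"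
    by (simp add: mult_ac)
  moreover have "0 < M\<^sup>2" using M by simp
  ultimately show ?thesis
    unfolding B_def[symmetric] M_def[symmetric] by (simp only: pos_le_divide_eq)
qed

text \<open>Three limits are taken in turn: the truncation length to infinity, the damping to 1, and
  the step \<open>h\<close> to 0.\<close>

lemma cut_bound_gram:
  fixes x :: "'a \<Rightarrow> nat \<Rightarrow> real"
  assumes G: "simple_graph V E" and t: "0 \<le> t"
    and unit: "\<And>v. v \<in> V \<Longrightarrow> (\<Sum>i<d. (x v i)\<^sup>2) = 1"
    and edge: "\<And>u v. u \<in> V \<Longrightarrow> v \<in> V \<Longrightarrow> u \<noteq> v \<Longrightarrow> {u, v} \<in> E \<Longrightarrow> (\<Sum>i<d. x u i * x v i) \<le> - t"
  shows "real (card E) - 2 * real (mc V E) \<le> - (t * real (card E) * (2 / pi))"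
proof -
  define B where "B = real (card E) - 2 * real (mc V E)"
  define T where "T = t * real (card E)"
  have T: "0 \<le> T" using t by (simp add: T_def)
  \<comment> \<open>The wave has length \<open>N\<close>, the coefficient only length
    \<open>K\<close>. All terms of the coefficient are nonnegative, so \<open>K\<close> can stay
    fixed while the normalising factor tends to 1.\<close>
  have lim_N: "B \<le> - (T * (sq_wave_coeff r K \<delta>)\<^sup>2)" if r: "0 < r" "r < 1" and \<delta>: "0 < \<delta>" for r K \<delta>
  proof (rule LIMSEQ_le_const2)
    have "(\<lambda>N. B * (1 + (4 / pi) * (r ^ N / (1 - r)))\<^sup>2) \<longlonglongrightarrow> B * (1 + (4 / pi) * (0 / (1 - r)))\<^sup>2"
      using r by (intro tendsto_intros LIMSEQ_realpow_zero) auto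
    then show "(\<lambda>N. B * (1 + (4 / pi) * (r ^ N / (1 - r)))\<^sup>2) \<longlonglongrightarrow> B" by simp
    have "B * (1 + (4 / pi) * (r ^ N / (1 - r)))\<^sup>2 \<le> - (T * (sq_wave_coeff r K \<delta>)\<^sup>2)" if "K \<le> N" for N
    proof -
      have "0 \<le> sq_wave_coeff r K \<delta>"
        unfolding sq_wave_coeff_def using r \<delta> by (intro mult_nonneg_nonneg sum_nonneg) auto
      moreover have "sq_wave_coeff r K \<delta> \<le> sq_wave_coeff r N \<delta>"
        unfolding sq_wave_coeff_def using r \<delta> that by (intro mult_left_mono sum_mono2) auto
      ultimately have "T * (sq_wave_coeff r K \<delta>)\<^sup>2 \<le> T * (sq_wave_coeff r N \<delta>)\<^sup>2"
        using T by (intro mult_left_mono power_mono) auto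
      moreover have "B * (1 + (4 / pi) * (r ^ N / (1 - r)))\<^sup>2 \<le> - (T * (sq_wave_coeff r N \<delta>)\<^sup>2)"
        unfolding B_def T_def by (rule cut_bound_sq_wave[OF G r \<delta> t]) (fact unit, fact edge)
      ultimately show ?thesis by linarith
    qed
    then show "\<exists>K'. \<forall>N\<ge>K'. B * (1 + (4 / pi) * (r ^ N / (1 - r)))\<^sup>2 \<le> - (T * (sq_wave_coeff r K \<delta>)\<^sup>2)" by blast
  qed
  have lim_r: "B \<le> - (T * (sq_wave_coeff 1 K \<delta>)\<^sup>2)" if \<delta>: "0 < \<delta>" for K \<delta>
  proof (rule tendsto_lowerbound)
    show "((\<lambda>r. - (T * (sq_wave_coeff r K \<delta>)\<^sup>2)) \<longlongrightarrow> - (T * (sq_wave_coeff 1 K \<delta>)\<^sup>2)) (at_left 1)"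
      unfolding sq_wave_coeff_def by (intro tendsto_intros)
    show "\<forall>\<^sub>F r in at_left 1. B \<le> - (T * (sq_wave_coeff r K \<delta>)\<^sup>2)"
      using eventually_at_left_real[of 0 1] lim_N \<delta> by (auto elim!: eventually_mono)
  qed simp
  \<comment> \<open>The second condition on \<open>h\<close> keeps the lower bound for the
    coefficient positive, so that it may be squared.\<close>
  have small: "B \<le> - (T * ((2 * sqrt 2 / pi) * (sqrt pi / 2 - 2 * h))\<^sup>2)" if h: "0 < h" "2 * h < sqrt pi / 2" for h
  proof -
    obtain N where N: "sqrt pi / 2 - h - h \<le> 2 * h * (\<Sum>j<N. exp (- (real (2 * j + 1) * h)\<^sup>2))"
      using exists_gauss_sum_ge[OF h(1) h(1)] by blast
    \<comment> \<open>The choice \<delta> = \<open>sqrt 2 * h\<close> absorbs the 1/2 in the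
      Gaussian exponent and matches the Riemann sum.\<close>
    have "sq_wave_coeff 1 N (sqrt 2 * h) = (2 * sqrt 2 / pi) * (2 * h * (\<Sum>j<N. exp (- (real (2 * j + 1) * h)\<^sup>2)))"
      unfolding sq_wave_coeff_def by (simp add: power_mult_distrib sum_distrib_left mult_ac)
    then have "(2 * sqrt 2 / pi) * (sqrt pi / 2 - 2 * h) \<le> sq_wave_coeff 1 N (sqrt 2 * h)"
      using N by (simp only:) (intro mult_left_mono, auto)
    then have "T * ((2 * sqrt 2 / pi) * (sqrt pi / 2 - 2 * h))\<^sup>2 \<le> T * (sq_wave_coeff 1 N (sqrt 2 * h))\<^sup>2"
      using T h by (intro mult_left_mono power_mono) auto
    then show ?thesis using lim_r[of "sqrt 2 * h" N] h by simp
  qed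
  have "B \<le> - (T * ((2 * sqrt 2 / pi) * (sqrt pi / 2 - 2 * 0))\<^sup>2)"
  proof (rule tendsto_lowerbound)
    show "((\<lambda>h. - (T * ((2 * sqrt 2 / pi) * (sqrt pi / 2 - 2 * h))\<^sup>2))
      \<longlongrightarrow> - (T * ((2 * sqrt 2 / pi) * (sqrt pi / 2 - 2 * 0))\<^sup>2)) (at_right 0)"
      by (intro tendsto_intros)
    show "\<forall>\<^sub>F h in at_right 0. B \<le> - (T * ((2 * sqrt 2 / pi) * (sqrt pi / 2 - 2 * h))\<^sup>2)"
      using eventually_at_right_real[of 0 "sqrt pi / 4"] small by (auto elim!: eventually_mono)
  qed simp
  then show ?thesis
    by (simp add: B_def T_def power_mult_distrib power_divide) (simp add: power2_eq_square)
qed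

theorem theorem1p7:
  fixes V :: "'a set" and E :: "'a set set" and m :: nat
  assumes "simple_graph V E"
    and "card E = m"
  shows "sp V E \<ge> (1 / pi) * (real m / (chi_vec V E - 1))"
proof -
  define t where "t = 1 / (chi_vec V E - 1)"
  obtain d x where \<kappa>: "chi_vec V E \<ge> 2" and col: "vector_colouring (chi_vec V E) d x V E"
    using chi_vec_attained[OF assms(1)] by blast
  have "real (card E) - 2 * real (mc V E) \<le> - (t * real (card E) * (2 / pi))"
  proof (rule cut_bound_gram[OF assms(1), where x = "\<lambda>v i. vec_index (x v) i" and d = d])
    show "(\<Sum>i<d. (vec_index (x v) i)\<^sup>2) = 1" if "v \<in> V" for v
      using vector_colouring_gram(2)[OF col that] by (simp add: power2_eq_square)
    show "(\<Sum>i<d. vec_index (x u) i * vec_index (x v) i) \<le> - t"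
      if "u \<in> V" "v \<in> V" "u \<noteq> v" "{u, v} \<in> E" for u v
      unfolding t_def by (rule vector_colouring_gram(3)[OF col that])
  qed (use \<kappa> in \<open>simp add: t_def\<close>)
  \<comment> \<open>\<open>sp\<close> is half of \<open>2 * mc - card E\<close>, so 2 / pi becomes 1
    / pi.\<close>
  then have "t * real m / pi \<le> sp V E" using assms(2) by (simp add: sp_def)
  then show ?thesis by (simp add: t_def mult.commute)
qed

end
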